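(* Assume the Continuum Hypothesis. Then there exist $2^{\mathfrak c}$ pairwise non-isomorphic P-points on $\mathbb N$ that are not quasi-selective, and $2^{\mathfrak c}$ pairwise non-isomorphic quasi-selective ultrafilters on $\mathbb N$ that are not selective.
   Context: $\mathbb N=\{0,1,2,\dots\}$, $\mathfrak c=2^{\aleph_0}$. A nonprincipal ultrafilter $\mathcal U$ on $\mathbb N$ is quasi-selective if every $f:\mathbb N\to\mathbb N$ with $f(n)\le n$ for all $n$ agrees on a set in $\mathcal U$ with a nondecreasing function; it is selective if every $f:\mathbb N\to\mathbb N$ agrees on a set in $\mathcal U$ with a nondecreasing function. Ultrafilters $\mathcal U,\mathcal V$ are isomorphic if $\mathcal V=\{B: f^{-1}(B)\in\mathcal U\}$ for some bijection $f$ of $\mathbb N$. *)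

theory Defs
  imports Main
begin

unbundle cardinal_syntax

text \<open>
  An ultrafilter on \<open>\<nat>\<close> is a value of the library type \<^typ>\<open>nat filter\<close>; a set \<open>A\<close> belongs to
  \<open>U\<close> iff \<open>\<forall>\<^sub>F n in U. n \<in> A\<close>. The library type includes the improper filter \<^term>\<open>bot\<close>.
\<close>

definition ultrafilter :: "'a filter \<Rightarrow> bool" where
  "ultrafilter U \<longleftrightarrow>
     U \<noteq> bot \<and> (\<forall>P. eventually P U \<or> eventually (\<lambda>x. \<not> P x) U)"

definition nonprincipal_ultrafilter :: "'a filter \<Rightarrow> bool" where
  "nonprincipal_ultrafilter U \<longleftrightarrow> ultrafilter U \<and> (\<forall>a. U \<noteq> principal {a})"

definition quasi_selective :: "nat filter \<Rightarrow> bool" where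
  "quasi_selective U \<longleftrightarrow> nonprincipal_ultrafilter U \<and>
     (\<forall>f :: nat \<Rightarrow> nat. (\<forall>n. f n \<le> n) \<longrightarrow> (\<exists>g. mono g \<and> (\<forall>\<^sub>F n in U. f n = g n)))"

definition selective :: "nat filter \<Rightarrow> bool" where
  "selective U \<longleftrightarrow> nonprincipal_ultrafilter U \<and>
     (\<forall>f :: nat \<Rightarrow> nat. \<exists>g. mono g \<and> (\<forall>\<^sub>F n in U. f n = g n))"

definition p_point :: "nat filter \<Rightarrow> bool" where
  "p_point U \<longleftrightarrow> nonprincipal_ultrafilter U \<and>
     (\<forall>f :: nat \<Rightarrow> nat. \<exists>A. (\<forall>\<^sub>F n in U. n \<in> A) \<and>
        ((\<exists>c. \<forall>n\<in>A. f n = c) \<or> (\<forall>k. finite {n \<in> A. f n = k})))"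

text \<open>
  \<^term>\<open>filtermap f U\<close> is the filter of all \<open>B\<close> with \<open>f\<close>-preimage in \<open>U\<close>.
\<close>

definition isomorphic_ultrafilters :: "nat filter \<Rightarrow> nat filter \<Rightarrow> bool" where
  "isomorphic_ultrafilters U V \<longleftrightarrow> (\<exists>f :: nat \<Rightarrow> nat. bij f \<and> V = filtermap f U)"

text \<open>
  Cardinals are represented, as in the library, by well-order relations up to \<open>=o\<close>:
  \<^term>\<open>natLeq\<close> is \<open>\<aleph>\<^sub>0\<close> and \<^term>\<open>cardSuc natLeq\<close> is \<open>\<aleph>\<^sub>1\<close>.
\<close>

definition continuum :: "(nat \<Rightarrow> bool) rel" where
  "continuum = ctwo ^c natLeq"

definition two_to_continuum :: "((nat \<Rightarrow> bool) \<Rightarrow> bool) rel" where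
  "two_to_continuum = ctwo ^c continuum"

definition Continuum_Hypothesis :: bool where
  "Continuum_Hypothesis \<longleftrightarrow> continuum =o cardSuc natLeq"

end

theory Submission
  imports Defs Complex_Main "HOL-Library.Countable_Set"
begin

text \<open>
  Fix a notion of \<open>n\<close>-largeness of finite sets for which every two-part partition of an
  \<open>(n+1)\<close>-large set has an \<open>n\<close>-large subset in one part, and call a set positive if it has
  \<open>n\<close>-large subsets for all \<open>n\<close>. Positivity is partition regular, every positive set splits
  into two, and decreasing sequences of positive sets have positive pseudo-intersections. Under CH
  a binary tree of height \<open>\<omega>\<^sub>1\<close> of almost decreasing positive sets can therefore meet one
  requirement for each function \<open>\<nat> \<rightarrow> \<nat>\<close>; its \<open>2\<^sup>c\<close> branches generate distinct P-points
  whose members are all positive. An isomorphism class has at most \<open>c\<close> elements, so \<open>2\<^sup>c\<close>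
  pairwise non-isomorphic ones remain.

  If largeness forces two points in a common interval of a partition of \<open>\<nat>\<close>, then the function
  reversing each interval is nondecreasing on no positive set. With dyadic intervals and
  cardinality as largeness, this function lies below the identity. With sparse intervals and a
  largeness that also makes every \<open>f \<le> id\<close> nondecreasing on an \<open>n\<close>-large subset of each
  \<open>(n+1)\<close>-large set, the ultrafilters are quasi-selective, but the reversal prevents
  selectivity.
\<close>

section \<open>Positive sets\<close>

text \<open>The bound \<open>b n\<close> below which nothing more is picked dominates
  \<open>t x\<close> for every point \<open>x\<close> picked earlier. The growth demand
  \<open>t\<close> is \<open>Suc\<close> when separated pieces are wanted, and in
  \<open>pos_mono_on\<close> a threshold past which a given function stays large.\<close>

lemma finite_sequence_choice:
  fixes t :: "nat \<Rightarrow> nat" and Q :: "nat \<Rightarrow> nat set \<Rightarrow> bool"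
  assumes ex: "\<And>n m. \<exists>F. finite F \<and> F \<subseteq> {m..} \<and> Q n F"
  shows "\<exists>F. \<forall>n. finite (F n) \<and> Q n (F n) \<and> (\<forall>m<n. \<forall>x\<in>F m. \<forall>y\<in>F n. t x \<le> y)"
proof -
  define pick where "pick n m = (SOME F. finite F \<and> F \<subseteq> {m..} \<and> Q n F)" for n m
  have pick: "finite (pick n m) \<and> pick n m \<subseteq> {m..} \<and> Q n (pick n m)" for n m
    unfolding pick_def by (rule someI_ex[OF ex])
  \<comment> \<open>The sum is a convenient upper bound of \<open>t\<close> on the finite set just
    picked, valid also when that set is empty.\<close>
  define b where "b = rec_nat (0::nat) (\<lambda>n m. m + sum t (pick n m))"
  have b_Suc: "b (Suc n) = b n + sum t (pick n (b n))" for n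
    by (simp add: b_def)
  have b_mono: "m \<le> n \<Longrightarrow> b m \<le> b n" for m n
    by (rule lift_Suc_mono_le) (simp_all add: b_Suc)
  have "t x \<le> y" if "m < n" "x \<in> pick m (b m)" "y \<in> pick n (b n)" for m n x y
  proof -
    have "t x \<le> sum t (pick m (b m))"
      using that pick by (intro member_le_sum) auto
    also have "\<dots> \<le> b (Suc m)" by (simp add: b_Suc)
    also have "\<dots> \<le> b n" using that by (intro b_mono) simp
    also have "\<dots> \<le> y" using that pick by blast
    finally show ?thesis .
  qed
  then show ?thesis using pick by (intro exI[of _ "\<lambda>n. pick n (b n)"]) blast
qed

text \<open>Upward closure in the set is not demanded: in both applications a large set lies within
  one interval of a partition. Hence splitting and positivity speak of large subsets.\<close>

locale largeness =
  fixes L :: "nat \<Rightarrow> nat set \<Rightarrow> bool"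
  assumes large_finite: "L n F \<Longrightarrow> finite F"
    and large_split: "L (Suc n) F \<Longrightarrow> \<exists>G\<subseteq>F. L n G \<and> (G \<subseteq> B \<or> G \<inter> B = {})"
    and large_0: "L 0 F \<Longrightarrow> 2 \<le> card F"
    and large_exists: "\<exists>F. L n F"
begin

definition pos :: "nat set \<Rightarrow> bool" where
  "pos A \<longleftrightarrow> (\<forall>n. \<exists>F\<subseteq>A. L n F)"

lemma pos_UNIV: "pos UNIV"
  using large_exists by (simp add: pos_def)

lemma pos_mono: "pos A \<Longrightarrow> A \<subseteq> B \<Longrightarrow> pos B"
  unfolding pos_def by (meson subset_trans)

lemma large_mono: "m \<le> n \<Longrightarrow> L n F \<Longrightarrow> \<exists>G\<subseteq>F. L m G"
proof (induction n arbitrary: F rule: dec_induct)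
  case (step n)
  then show ?case using large_split[of n F] by (meson subset_trans)
qed auto

text \<open>If the two parts failed at levels \<open>m\<close> and \<open>n\<close>, a subset of
  \<open>A\<close> of level \<open>max m n + 1\<close> would still leave a set of level
  \<open>max m n\<close> in one part, and \<open>large_mono\<close> descends from there to both
  \<open>m\<close> and \<open>n\<close>.\<close>

lemma pos_split:
  assumes "pos A"
  shows "pos (A \<inter> B) \<or> pos (A - B)"
proof (rule ccontr)
  assume neg: "\<not> ?thesis"
  from neg have "\<not> pos (A \<inter> B)" by simp
  then obtain m where m: "\<And>F. F \<subseteq> A \<inter> B \<Longrightarrow> \<not> L m F" unfolding pos_def by metis
  from neg have "\<not> pos (A - B)" by simp
  then obtain n where n: "\<And>F. F \<subseteq> A - B \<Longrightarrow> \<not> L n F" unfolding pos_def by metis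
  obtain F where F: "F \<subseteq> A" "L (Suc (max m n)) F"
    using assms unfolding pos_def by blast
  obtain G where G: "G \<subseteq> F" "L (max m n) G" "G \<subseteq> B \<or> G \<inter> B = {}"
    using large_split[OF F(2)] by blast
  obtain G1 where G1: "G1 \<subseteq> G" "L m G1"
    using large_mono[OF _ G(2), of m] by auto
  obtain G2 where G2: "G2 \<subseteq> G" "L n G2"
    using large_mono[OF _ G(2), of n] by auto
  have "G1 \<subseteq> A \<inter> B \<or> G2 \<subseteq> A - B"
    using G(1,3) F(1) G1(1) G2(1) by auto
  then show False using m[of G1] n[of G2] G1(2) G2(2) by auto
qed

text \<open>Splitting off a single point \<open>x\<close> costs one level, and the remaining large
  set must avoid \<open>x\<close> because it has at least two points. So each level adds a
  point.\<close>

lemma large_card: "L n F \<Longrightarrow> n + 2 \<le> card F"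
proof (induction n arbitrary: F)
  case 0
  then show ?case using large_0[of F] by simp
next
  case (Suc n)
  have fin: "finite F" using Suc.prems by (rule large_finite)
  have "F \<noteq> {}"
  proof
    assume "F = {}"
    then obtain G where "G \<subseteq> {}" "L n G" using large_split[OF Suc.prems, of UNIV] by blast
    then show False using Suc.IH[of G] by simp
  qed
  then obtain x where x: "x \<in> F" by blast
  obtain G where G: "G \<subseteq> F" "L n G" "G \<subseteq> {x} \<or> G \<inter> {x} = {}"
    using large_split[OF Suc.prems] by blast
  have G2: "n + 2 \<le> card G" using Suc.IH G by blast
  have "\<not> G \<subseteq> {x}"
  proof
    assume "G \<subseteq> {x}"
    from card_mono[OF _ this] G2 show False by simp
  qed
  then have "G \<subset> F" using G x by blast
  then have "card G < card F" using fin by (rule psubset_card_mono[rotated])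
  then show ?case using G2 by simp
qed

lemma pos_infinite:
  assumes "pos A"
  shows "infinite A"
proof
  assume fin: "finite A"
  obtain F where "F \<subseteq> A" "L (card A) F" using assms unfolding pos_def by blast
  then show False using large_card[of "card A" F] card_mono[OF fin, of F] by simp
qed

text \<open>By \<open>pos_split\<close>, since a finite remainder \<open>A - B\<close> cannot be the
  positive part.\<close>

lemma pos_almost_mono:
  assumes "pos A" "finite (A - B)"
  shows "pos B"
  using pos_split[OF assms(1), of B] pos_infinite[of "A - B"] pos_mono[of "A \<inter> B" B] assms(2)
  by auto

lemma pos_large_above:
  assumes "pos A"
  shows "\<exists>F. F \<subseteq> A \<and> L n F \<and> F \<subseteq> {m..}"
proof -
  have "finite (A - A \<inter> {m..})" by (rule finite_subset[of _ "{..<m}"]) auto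
  then have "pos (A \<inter> {m..})" using pos_almost_mono[OF assms] by simp
  then obtain F where "F \<subseteq> A \<inter> {m..}" "L n F" unfolding pos_def by blast
  then show ?thesis by auto
qed

lemma pos_if_unbounded:
  assumes "\<And>n::nat. \<exists>m\<ge>n. \<exists>F\<subseteq>A. L m F"
  shows "pos A"
  unfolding pos_def
proof
  fix n
  obtain m F where "n \<le> m" "F \<subseteq> A" "L m F" using assms by blast
  then show "\<exists>G\<subseteq>A. L n G" using large_mono[of n m F] by blast
qed

text \<open>\<open>B\<close> is a union of \<open>n\<close>-large pieces
  \<open>F n \<subseteq> A n\<close>; if the later sets stay inside \<open>A n\<close>, only the
  finitely many pieces before \<open>n\<close> can leave it. Containment in the union keeps
  \<open>B\<close> inside a given set when all \<open>A n\<close> are.\<close>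

lemma pos_sequence_pseudointersection:
  fixes A :: "nat \<Rightarrow> nat set"
  assumes A: "\<And>n. pos (A n)"
  shows "\<exists>B. pos B \<and> B \<subseteq> (\<Union>n. A n) \<and> (\<forall>n. (\<forall>m\<ge>n. A m \<subseteq> A n) \<longrightarrow> finite (B - A n))"
proof -
  have "\<exists>F\<subseteq>A n. L n F" for n using A unfolding pos_def by blast
  then obtain F where "\<And>n. F n \<subseteq> A n \<and> L n (F n)" by metis
  with large_finite have F: "finite (F n) \<and> F n \<subseteq> A n \<and> L n (F n)" for n by blast
  have "finite ((\<Union>n. F n) - A n)" if n: "\<forall>m\<ge>n. A m \<subseteq> A n" for n
  proof (rule finite_subset)
    show "(\<Union>n. F n) - A n \<subseteq> (\<Union>m<n. F m)"
    proof
      fix x assume "x \<in> (\<Union>n. F n) - A n"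
      then obtain m where "x \<in> F m" "x \<notin> A n" by blast
      moreover from this F[of m] n have "m < n" by (meson in_mono leI)
      ultimately show "x \<in> (\<Union>m<n. F m)" by blast
    qed
    show "finite (\<Union>m<n. F m)" using F by blast
  qed
  moreover have "pos (\<Union>n. F n)" by (rule pos_if_unbounded) (use F in blast)
  moreover have "(\<Union>n. F n) \<subseteq> (\<Union>n. A n)" using F by blast
  ultimately show ?thesis by blast
qed

text \<open>In a chain modulo finite sets, every finite intersection almost contains one of the
  members, hence is positive. The finite intersections decrease, so they have a positive
  pseudo-intersection.\<close>

lemma countable_chain_pseudointersection:
  assumes "countable K" and pos: "\<And>X. X \<in> K \<Longrightarrow> pos X"
    and chain: "\<And>X Y. X \<in> K \<Longrightarrow> Y \<in> K \<Longrightarrow> finite (X - Y) \<or> finite (Y - X)"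
  shows "\<exists>A. pos A \<and> (\<forall>X\<in>K. finite (A - X))"
proof (cases "K = {}")
  case True
  then show ?thesis using pos_UNIV by blast
next
  case False
  define k where "k = from_nat_into K"
  have range_k: "range k = K"
    using False assms(1) by (simp add: k_def range_from_nat_into)
  then have k: "k n \<in> K" for n by blast
  define A where "A n = (\<Inter>m\<le>n. k m)" for n
  have "\<exists>m. finite (k m - A n)" for n
  proof (induction n)
    case 0
    show ?case by (rule exI[of _ 0]) (simp add: A_def)
  next
    case (Suc n)
    then obtain m where m: "finite (k m - A n)" by blast
    have eq: "A (Suc n) = A n \<inter> k (Suc n)" by (auto simp: A_def le_Suc_eq)
    from chain[OF k[of m] k[of "Suc n"]] show ?case
    proof
      assume "finite (k m - k (Suc n))"
      with m have "finite (k m - A (Suc n))" by (simp add: eq Diff_Int)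
      then show ?thesis by blast
    next
      assume "finite (k (Suc n) - k m)"
      with m have "finite ((k (Suc n) - k m) \<union> (k m - A n))" by blast
      then have "finite (k (Suc n) - A (Suc n))"
        by (rule rev_finite_subset) (auto simp: eq)
      then show ?thesis by blast
    qed
  qed
  then have "pos (A n)" for n using pos_almost_mono pos k by metis
  then obtain B where B: "pos B" "\<And>n. (\<forall>m\<ge>n. A m \<subseteq> A n) \<longrightarrow> finite (B - A n)"
    using pos_sequence_pseudointersection[of A] by blast
  have "finite (B - k n)" for n
  proof (rule finite_subset)
    show "B - k n \<subseteq> B - A n" by (auto simp: A_def)
    have "A m \<subseteq> A n" if "m \<ge> n" for m
      unfolding A_def using that by (intro INT_anti_mono) auto
    then show "finite (B - A n)" using B(2) by simp
  qed
  then show ?thesis using B(1) range_k by blast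
qed

text \<open>Pairwise disjoint large pieces of \<open>A\<close> are sorted by the parity of their
  index; either class has pieces of unbounded level.\<close>

lemma pos_halves:
  assumes "pos A"
  shows "\<exists>B. pos (A \<inter> B) \<and> pos (A - B)"
proof -
  have "\<exists>F. finite F \<and> F \<subseteq> {m..} \<and> (F \<subseteq> A \<and> L n F)" for n m
  proof -
    obtain F where "F \<subseteq> A" "L n F" "F \<subseteq> {m..}" using pos_large_above[OF assms] by metis
    then show ?thesis using large_finite by (intro exI[of _ F]) simp
  qed
  \<comment> \<open>With \<open>t = Suc\<close>, the spacing says \<open>x < y\<close>, which makes
    the pieces disjoint.\<close>
  from finite_sequence_choice[of "\<lambda>n F. F \<subseteq> A \<and> L n F" Suc, OF this]
  obtain F where F': "\<forall>n. finite (F n) \<and> (F n \<subseteq> A \<and> L n (F n)) \<and>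
      (\<forall>m<n. \<forall>x\<in>F m. \<forall>y\<in>F n. Suc x \<le> y)"
    by (elim exE) (rule that)
  then have F: "F n \<subseteq> A" "L n (F n)" for n by simp_all
  have less: "x < y" if "m < n" "x \<in> F m" "y \<in> F n" for m n x y
    using F' that by (simp add: Suc_le_eq)
  have disj: "F m \<inter> F n = {}" if "m \<noteq> n" for m n
  proof (rule ccontr)
    assume "F m \<inter> F n \<noteq> {}"
    then obtain x where x: "x \<in> F m" "x \<in> F n" by auto
    show False using less[OF _ x] less[OF _ x(2,1)] that by (cases "m < n") simp_all
  qed
  let ?B = "\<Union>n. F (2 * n)"
  have "pos (A \<inter> ?B)"
  proof (rule pos_if_unbounded)
    fix n
    have "F (2 * n) \<subseteq> A \<inter> ?B" using F(1) by blast
    then show "\<exists>m\<ge>n. \<exists>G\<subseteq>A \<inter> ?B. L m G"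
      using F(2)[of "2 * n"] by (intro exI[of _ "2 * n"] conjI exI[of _ "F (2 * n)"]) simp_all
  qed
  moreover have "pos (A - ?B)"
  proof (rule pos_if_unbounded)
    fix n
    have "F (2 * n + 1) \<inter> F (2 * m) = {}" for m by (rule disj) presburger
    then have "F (2 * n + 1) \<subseteq> A - ?B" using F(1)[of "2 * n + 1"] by blast
    then show "\<exists>m\<ge>n. \<exists>G\<subseteq>A - ?B. L m G"
      using F(2)[of "2 * n + 1"]
      by (intro exI[of _ "2 * n + 1"] conjI exI[of _ "F (2 * n + 1)"]) simp_all
  qed
  ultimately show ?thesis by (intro exI[of _ ?B] conjI)
qed

text \<open>The P-point condition at \<open>f\<close>, isolated as a property of one set so that a
  single stage of the tower can secure it.\<close>

definition constant_or_finite_to_one :: "(nat \<Rightarrow> nat) \<Rightarrow> nat set \<Rightarrow> bool" where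
  "constant_or_finite_to_one f A \<longleftrightarrow> (\<exists>c. \<forall>n\<in>A. f n = c) \<or> (\<forall>k. finite {n \<in> A. f n = k})"

lemma constant_or_finite_to_one_subset:
  assumes "constant_or_finite_to_one f A" "B \<subseteq> A"
  shows "constant_or_finite_to_one f B"
  using assms(1) unfolding constant_or_finite_to_one_def
proof
  assume "\<exists>c. \<forall>n\<in>A. f n = c"
  then show "(\<exists>c. \<forall>n\<in>B. f n = c) \<or> (\<forall>k. finite {n \<in> B. f n = k})"
    using assms(2) by (meson subsetD)
next
  assume fin: "\<forall>k. finite {n \<in> A. f n = k}"
  have "finite {n \<in> B. f n = k}" for k
  proof (rule finite_subset)
    show "{n \<in> B. f n = k} \<subseteq> {n \<in> A. f n = k}" using assms(2) by auto
    show "finite {n \<in> A. f n = k}" using fin by simp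
  qed
  then show "(\<exists>c. \<forall>n\<in>B. f n = c) \<or> (\<forall>k. finite {n \<in> B. f n = k})" by simp
qed

text \<open>If no fibre of \<open>f\<close> in \<open>A\<close> is positive, removing the fibres one
  by one leaves positive sets \<open>C k\<close>. A pseudo-intersection meets the fibre over
  \<open>k\<close> in a finite set, because that fibre is disjoint from
  \<open>C (Suc k)\<close>.\<close>

lemma pos_constant_or_finite_to_one:
  assumes "pos A"
  shows "\<exists>B\<subseteq>A. pos B \<and> constant_or_finite_to_one f B"
proof (cases "\<exists>c. pos (A \<inter> {n. f n = c})")
  case True
  then obtain c where "pos (A \<inter> {n. f n = c})" by blast
  then show ?thesis
    by (intro exI[of _ "A \<inter> {n. f n = c}"]) (auto simp: constant_or_finite_to_one_def)
next
  case False
  define C where "C k = A \<inter> {n. k \<le> f n}" for k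
  have posC: "pos (C k)" for k
  proof (induction k)
    case 0
    then show ?case using assms by (simp add: C_def)
  next
    case (Suc k)
    have "\<not> pos (C k \<inter> {n. f n = k})"
      using False pos_mono[of "C k \<inter> {n. f n = k}" "A \<inter> {n. f n = k}"] by (auto simp: C_def)
    then have "pos (C k - {n. f n = k})" using pos_split[OF Suc.IH] by blast
    then show ?case by (rule pos_mono) (auto simp: C_def)
  qed
  obtain B where B: "pos B" "B \<subseteq> (\<Union>k. C k)"
      "\<And>k. (\<forall>m\<ge>k. C m \<subseteq> C k) \<longrightarrow> finite (B - C k)"
    using pos_sequence_pseudointersection[of C, OF posC] by blast
  have "finite {n \<in> B. f n = k}" for k
  proof (rule finite_subset)
    show "{n \<in> B. f n = k} \<subseteq> B - C (Suc k)" by (auto simp: C_def)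
    show "finite (B - C (Suc k))" using B(3)[of "Suc k"] by (force simp: C_def)
  qed
  moreover have "B \<subseteq> A" using B(2) by (auto simp: C_def)
  ultimately show ?thesis using B(1) by (auto simp: constant_or_finite_to_one_def)
qed

end

section \<open>A tower of positive sets\<close>

text \<open>The cardinal \<open>|UNIV|\<close> is itself a concrete well-order of the type. Its
  strict part orders the stages of the tower.\<close>

lemma card_of_UNIV_wellorder:
  fixes r :: "'a rel"
  assumes "r = |UNIV|"
  shows "wf (r - Id)" "a = b \<or> (a, b) \<in> r - Id \<or> (b, a) \<in> r - Id" "trans (r - Id)"
proof -
  have r: "well_order_on UNIV r" using assms by (simp add: card_of_well_order_on)
  then show "wf (r - Id)" by (simp add: well_order_on_def)
  show "a = b \<or> (a, b) \<in> r - Id \<or> (b, a) \<in> r - Id"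
    using r by (auto simp: well_order_on_def linear_order_on_def total_on_def)
  show "trans (r - Id)"
    using r by (auto simp: well_order_on_def linear_order_on_def partial_order_on_def
        preorder_on_def intro: trans_diff_Id)
qed

lemma continuum_eq: "continuum = |UNIV|"
  by (simp add: continuum_def cexp_def ctwo_def Func_def Field_natLeq Field_card_of)

lemma two_to_continuum_eq: "two_to_continuum = |UNIV|"
  by (simp add: two_to_continuum_def continuum_eq cexp_def ctwo_def Func_def Field_card_of)

text \<open>A function is coded by the characteristic function of its graph, read through a pairing
  of the naturals.\<close>

lemma card_of_nat_fun: "|UNIV :: (nat \<Rightarrow> nat) set| =o continuum"
proof -
  have "inj (\<lambda>(f :: nat \<Rightarrow> nat) n. f (fst (prod_decode n)) = snd (prod_decode n))"
  proof (rule injI, rule ext)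
    fix f g :: "nat \<Rightarrow> nat" and m
    assume "(\<lambda>n. f (fst (prod_decode n)) = snd (prod_decode n)) =
      (\<lambda>n. g (fst (prod_decode n)) = snd (prod_decode n))"
    from fun_cong[OF this, of "prod_encode (m, f m)"] show "f m = g m" by simp
  qed
  then have "|UNIV :: (nat \<Rightarrow> nat) set| \<le>o |UNIV :: (nat \<Rightarrow> bool) set|"
    unfolding card_of_ordLeq[symmetric] by blast
  moreover have "inj (\<lambda>(A :: nat \<Rightarrow> bool) n. of_bool (A n) :: nat)"
    by (rule injI) (simp add: fun_eq_iff of_bool_eq_iff)
  then have "|UNIV :: (nat \<Rightarrow> bool) set| \<le>o |UNIV :: (nat \<Rightarrow> nat) set|"
    unfolding card_of_ordLeq[symmetric] by blast
  ultimately show ?thesis by (simp add: continuum_eq ordIso_iff_ordLeq)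
qed

text \<open>Functions serve twice: as indices of the requirements \<open>D f\<close> and, once
  well-ordered, as stages of the tower, so that stage \<open>f\<close> meets
  \<open>D f\<close>.\<close>

locale dense_requirements = largeness L for L +
  fixes D :: "(nat \<Rightarrow> nat) \<Rightarrow> nat set \<Rightarrow> bool"
  assumes dense: "pos A \<Longrightarrow> \<exists>B\<subseteq>A. pos B \<and> D f B"
begin

text \<open>This choice and those in \<open>half\<close> and \<open>refine\<close> depend on the
  arguments alone. Branches that agree up to a stage therefore split the same set there, as
  \<open>tower_disjoint\<close> requires.\<close>

definition lower_bound :: "nat set set \<Rightarrow> nat set" where
  "lower_bound K = (SOME A. pos A \<and> (\<forall>X\<in>K. finite (A - X)))"

definition half :: "bool \<Rightarrow> nat set \<Rightarrow> nat set" where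
  "half b A = (let B = SOME B. pos (A \<inter> B) \<and> pos (A - B) in if b then A \<inter> B else A - B)"

definition refine :: "(nat \<Rightarrow> nat) \<Rightarrow> nat set \<Rightarrow> nat set" where
  "refine f A = (SOME B. B \<subseteq> A \<and> pos B \<and> D f B)"

lemma pos_half: "pos A \<Longrightarrow> pos (half b A)"
  using someI_ex[OF pos_halves[of A]] by (simp add: half_def Let_def)

lemma half_subset: "half b A \<subseteq> A"
  by (auto simp: half_def Let_def)

lemma half_disjoint: "b \<noteq> c \<Longrightarrow> half b A \<inter> half c A = {}"
  by (auto simp: half_def Let_def)

lemma refine: "pos A \<Longrightarrow> refine f A \<subseteq> A \<and> pos (refine f A) \<and> D f (refine f A)"
  unfolding refine_def by (rule someI_ex[OF dense])

abbreviation before :: "((nat \<Rightarrow> nat) \<times> (nat \<Rightarrow> nat)) set" where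
  "before \<equiv> |UNIV| - Id"

lemma before_trans: "(k, g) \<in> before \<Longrightarrow> (g, f) \<in> before \<Longrightarrow> (k, f) \<in> before"
  by (rule transD[OF card_of_UNIV_wellorder(3)[OF refl]])

text \<open>\<open>h\<close> is a branch of the binary tree: at stage \<open>f\<close> it selects
  one half of a lower bound of all earlier stages, which is then refined.\<close>

definition tower :: "((nat \<Rightarrow> nat) \<Rightarrow> bool) \<Rightarrow> (nat \<Rightarrow> nat) \<Rightarrow> nat set" where
  "tower h = wfrec before
     (\<lambda>p f. refine f (half (h f) (lower_bound (p ` {g. (g, f) \<in> before}))))"

lemma tower_rec:
  "tower h f = refine f (half (h f) (lower_bound (tower h ` {g. (g, f) \<in> before})))"
proof -
  have "cut (tower h) before f ` {g. (g, f) \<in> before} = tower h ` {g. (g, f) \<in> before}"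
    by (intro image_cong refl) (simp add: cut_def)
  then show ?thesis
    unfolding tower_def
    by (subst wfrec[OF card_of_UNIV_wellorder(1)[OF refl]]) (simp only:)
qed

context
  assumes CH: Continuum_Hypothesis
begin

text \<open>This is the only use of CH: the well-order has type \<open>\<omega>\<^sub>1\<close>.\<close>

lemma countable_before: "countable {g. (g, f) \<in> before}"
proof -
  have "|underS |UNIV :: (nat \<Rightarrow> nat) set| f| <o |UNIV :: (nat \<Rightarrow> nat) set|"
    by (rule card_of_underS) (simp_all add: card_of_card_order_on Field_card_of)
  moreover have "|UNIV :: (nat \<Rightarrow> nat) set| =o cardSuc natLeq"
    using card_of_nat_fun CH unfolding Continuum_Hypothesis_def by (rule ordIso_transitive)
  ultimately have "|underS |UNIV :: (nat \<Rightarrow> nat) set| f| <o cardSuc natLeq"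
    by (rule ordLess_ordIso_trans)
  then have "|underS |UNIV :: (nat \<Rightarrow> nat) set| f| \<le>o natLeq"
    by (simp add: cardSuc_ordLeq_ordLess natLeq_Card_order card_of_Card_order)
  then have "|underS |UNIV :: (nat \<Rightarrow> nat) set| f| \<le>o |UNIV :: nat set|"
    using ordIso_symmetric[OF card_of_nat] by (rule ordLeq_ordIso_trans)
  then have "countable (underS |UNIV :: (nat \<Rightarrow> nat) set| f)"
    unfolding card_of_ordLeq[symmetric] countable_def by blast
  moreover have "underS |UNIV :: (nat \<Rightarrow> nat) set| f = {g. (g, f) \<in> before}"
    by (auto simp: underS_def)
  ultimately show ?thesis by simp
qed

text \<open>The claims are proved by one induction: a positive lower bound at stage \<open>f\<close>
  exists only because the earlier stages are positive and form a countable chain modulo finite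
  sets.\<close>

lemma tower:
  "pos (tower h f)"
  "D f (tower h f)"
  "(g, f) \<in> before \<Longrightarrow> finite (tower h f - tower h g)"
  "tower h f \<subseteq> half (h f) (lower_bound (tower h ` {g. (g, f) \<in> before}))"
proof -
  have "pos (tower h f) \<and> D f (tower h f) \<and>
      (\<forall>g. (g, f) \<in> before \<longrightarrow> finite (tower h f - tower h g)) \<and>
      tower h f \<subseteq> half (h f) (lower_bound (tower h ` {g. (g, f) \<in> before}))"
  proof (induction f rule: wf_induct_rule[OF card_of_UNIV_wellorder(1)[OF refl]])
    case (1 f)
    let ?K = "tower h ` {g. (g, f) \<in> before}"
    have "\<exists>A. pos A \<and> (\<forall>X\<in>?K. finite (A - X))"
    proof (rule countable_chain_pseudointersection)
      show "countable ?K" using countable_before by simp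
      show "pos X" if "X \<in> ?K" for X using that 1 by blast
      fix X Y assume "X \<in> ?K" "Y \<in> ?K"
      then obtain g g' where g: "X = tower h g" "(g, f) \<in> before"
          and g': "Y = tower h g'" "(g', f) \<in> before" by blast
      from card_of_UNIV_wellorder(2)[OF refl, of g g'] show "finite (X - Y) \<or> finite (Y - X)"
      proof (elim disjE)
        assume "(g, g') \<in> before"
        then have "finite (tower h g' - tower h g)" using 1[OF g'(2)] by simp
        then show ?thesis using g g' by simp
      next
        assume "(g', g) \<in> before"
        then have "finite (tower h g - tower h g')" using 1[OF g(2)] by simp
        then show ?thesis using g g' by simp
      qed (simp add: g g')
    qed
    then have low: "pos (lower_bound ?K) \<and> (\<forall>X\<in>?K. finite (lower_bound ?K - X))"
      unfolding lower_bound_def by (rule someI_ex)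
    have ref: "tower h f \<subseteq> half (h f) (lower_bound ?K) \<and> pos (tower h f) \<and> D f (tower h f)"
      unfolding tower_rec[of h f] using low by (intro refine pos_half) simp
    have "finite (tower h f - tower h g)" if "(g, f) \<in> before" for g
    proof (rule finite_subset)
      show "tower h f - tower h g \<subseteq> lower_bound ?K - tower h g"
        using ref half_subset by (meson Diff_mono order_refl order_trans)
      show "finite (lower_bound ?K - tower h g)" using low that by simp
    qed
    with ref show ?case by simp
  qed
  then show "pos (tower h f)" "D f (tower h f)"
    "(g, f) \<in> before \<Longrightarrow> finite (tower h f - tower h g)"
    "tower h f \<subseteq> half (h f) (lower_bound (tower h ` {g. (g, f) \<in> before}))"
    by simp_all
qed

lemma tower_linear: "finite (tower h f - tower h g) \<or> finite (tower h g - tower h f)"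
  using card_of_UNIV_wellorder(2)[OF refl, of f g] tower(3)[of f g h] tower(3)[of g f h] by auto

lemma tower_cong:
  assumes "\<And>g. g = f \<or> (g, f) \<in> before \<Longrightarrow> h g = h' g"
  shows "tower h f = tower h' f"
  using assms
proof (induction f rule: wf_induct_rule[OF card_of_UNIV_wellorder(1)[OF refl]])
  case (1 f)
  have "tower h g = tower h' g" if g: "(g, f) \<in> before" for g
  proof (rule "1.IH"[OF g])
    fix k assume k: "k = g \<or> (k, g) \<in> before"
    then have "(k, f) \<in> before" using g before_trans[of k g f] by (elim disjE) simp_all
    then show "h k = h' k" using "1.prems" by simp
  qed
  then have "tower h ` {g. (g, f) \<in> before} = tower h' ` {g. (g, f) \<in> before}"
    by (intro image_cong refl) simp
  moreover have "h f = h' f" using "1.prems" by simp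
  ultimately show ?case unfolding tower_rec[of h f] tower_rec[of h' f] by simp
qed

text \<open>Up to the first difference both branches have the same stages, hence the same lower
  bound, and then enter opposite halves of it.\<close>

lemma tower_disjoint:
  assumes agree: "\<And>g. (g, f) \<in> before \<Longrightarrow> h g = h' g" and neq: "h f \<noteq> h' f"
  shows "tower h f \<inter> tower h' f = {}"
proof -
  let ?A = "lower_bound (tower h ` {g. (g, f) \<in> before})"
  have "tower h g = tower h' g" if g: "(g, f) \<in> before" for g
  proof (rule tower_cong)
    fix k assume k: "k = g \<or> (k, g) \<in> before"
    then have "(k, f) \<in> before" using g before_trans[of k g f] by (elim disjE) simp_all
    then show "h k = h' k" by (rule agree)
  qed
  then have "tower h ` {g. (g, f) \<in> before} = tower h' ` {g. (g, f) \<in> before}"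
    by (intro image_cong refl) simp
  then have "tower h f \<inter> tower h' f \<subseteq> half (h f) ?A \<inter> half (h' f) ?A"
    using tower(4)[of h f] tower(4)[of h' f] by (intro Int_mono) simp_all
  then show ?thesis using half_disjoint[OF neq] by simp
qed

section \<open>The filter generated by a branch\<close>

definition tower_filter :: "((nat \<Rightarrow> nat) \<Rightarrow> bool) \<Rightarrow> nat filter" where
  "tower_filter h = Abs_filter (\<lambda>P. \<exists>f. finite {n \<in> tower h f. \<not> P n})"

text \<open>Closure under intersection comes from \<open>tower_linear\<close>: the almost smaller of
  two stages witnesses both memberships.\<close>

lemma eventually_tower_filter:
  "eventually P (tower_filter h) \<longleftrightarrow> (\<exists>f. finite {n \<in> tower h f. \<not> P n})"
  unfolding tower_filter_def
proof (rule eventually_Abs_filter, rule is_filter.intro)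
  show "\<exists>f. finite {n \<in> tower h f. \<not> True}" by simp
next
  fix P Q :: "nat \<Rightarrow> bool"
  assume "\<exists>f. finite {n \<in> tower h f. \<not> P n}" "\<exists>f. finite {n \<in> tower h f. \<not> Q n}"
  then obtain f g where fin: "finite {n \<in> tower h f. \<not> P n}" "finite {n \<in> tower h g. \<not> Q n}"
    by (elim exE) (rule that)
  from tower_linear[where h = h] show "\<exists>f. finite {n \<in> tower h f. \<not> (P n \<and> Q n)}"
  proof
    assume "finite (tower h f - tower h g)"
    with fin have "finite ({n \<in> tower h f. \<not> P n} \<union> {n \<in> tower h g. \<not> Q n} \<union>
        (tower h f - tower h g))" by simp
    then have "finite {n \<in> tower h f. \<not> (P n \<and> Q n)}" by (rule rev_finite_subset) auto
    then show ?thesis by (rule exI[of _ f])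
  next
    assume "finite (tower h g - tower h f)"
    with fin have "finite ({n \<in> tower h f. \<not> P n} \<union> {n \<in> tower h g. \<not> Q n} \<union>
        (tower h g - tower h f))" by simp
    then have "finite {n \<in> tower h g. \<not> (P n \<and> Q n)}" by (rule rev_finite_subset) auto
    then show ?thesis by (rule exI[of _ g])
  qed
next
  fix P Q :: "nat \<Rightarrow> bool"
  assume imp: "\<forall>n. P n \<longrightarrow> Q n" and "\<exists>f. finite {n \<in> tower h f. \<not> P n}"
  then obtain f where fin: "finite {n \<in> tower h f. \<not> P n}" by (elim exE) (rule that)
  from imp have "{n \<in> tower h f. \<not> Q n} \<subseteq> {n \<in> tower h f. \<not> P n}" by auto
  then have "finite {n \<in> tower h f. \<not> Q n}" using fin by (rule finite_subset)
  then show "\<exists>f. finite {n \<in> tower h f. \<not> Q n}" by (rule exI[of _ f])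
qed

lemma eventually_tower: "\<forall>\<^sub>F n in tower_filter h. n \<in> tower h f"
  unfolding eventually_tower_filter by (rule exI[of _ f]) simp

text \<open>This is how properties are later refuted: a set that is not positive can never enter the
  filter.\<close>

lemma eventually_tower_filter_pos:
  assumes "\<forall>\<^sub>F n in tower_filter h. n \<in> A"
  shows "pos A"
proof -
  obtain f where "finite {n \<in> tower h f. n \<notin> A}"
    using assms unfolding eventually_tower_filter by blast
  then have "finite (tower h f - A)" by (simp add: set_diff_eq)
  then show ?thesis by (rule pos_almost_mono[OF tower(1)])
qed

lemma tower_filter_not_bot: "tower_filter h \<noteq> bot"
proof
  assume "tower_filter h = bot"
  then have "pos {}" by (intro eventually_tower_filter_pos[where h = h]) simp
  then show False using pos_infinite by blast
qed

text \<open>At the least stage where two branches differ, their stages are disjoint, so one proper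
  filter cannot contain both.\<close>

lemma inj_tower_filter: "inj tower_filter"
proof (rule injI, rule ccontr)
  fix h h' :: "(nat \<Rightarrow> nat) \<Rightarrow> bool"
  assume eq: "tower_filter h = tower_filter h'" and "h \<noteq> h'"
  then obtain f where "f \<in> {f. h f \<noteq> h' f}" by blast
  then obtain f where f: "h f \<noteq> h' f" and min: "\<And>g. (g, f) \<in> before \<Longrightarrow> h g = h' g"
    by (rule wfE_min[OF card_of_UNIV_wellorder(1)[OF refl]]) auto
  have "\<forall>\<^sub>F n in tower_filter h. n \<in> tower h f" by (rule eventually_tower)
  moreover have "\<forall>\<^sub>F n in tower_filter h. n \<in> tower h' f"
    unfolding eq by (rule eventually_tower)
  ultimately have "\<forall>\<^sub>F n in tower_filter h. False"
    by (rule eventually_elim2)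
      (use tower_disjoint[where h = h and h' = h', OF min f] in blast)
  then show False using tower_filter_not_bot by (simp add: eventually_False)
qed

end

end

section \<open>Isomorphism classes\<close>

lemma isomorphic_ultrafilters_sym:
  assumes "isomorphic_ultrafilters U V"
  shows "isomorphic_ultrafilters V U"
proof -
  obtain f where f: "bij f" "V = filtermap f U"
    using assms unfolding isomorphic_ultrafilters_def by blast
  then have "U = filtermap (inv f) V"
    by (simp add: filtermap_filtermap o_def bij_is_inj filtermap_ident)
  then show ?thesis
    using bij_imp_bij_inv[OF f(1)] unfolding isomorphic_ultrafilters_def by blast
qed

lemma isomorphic_ultrafilters_trans:
  assumes "isomorphic_ultrafilters U V" "isomorphic_ultrafilters V W"
  shows "isomorphic_ultrafilters U W"
proof -
  obtain f where f: "bij f" "V = filtermap f U"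
    using assms(1) unfolding isomorphic_ultrafilters_def by blast
  obtain g where g: "bij g" "W = filtermap g V"
    using assms(2) unfolding isomorphic_ultrafilters_def by blast
  have "W = filtermap (g \<circ> f) U" by (simp add: f g filtermap_filtermap o_def)
  then show ?thesis
    using bij_comp[OF f(1) g(1)] unfolding isomorphic_ultrafilters_def by blast
qed

lemma isomorphic_ultrafilters_refl: "isomorphic_ultrafilters U U"
  unfolding isomorphic_ultrafilters_def by (rule exI[of _ id]) (simp add: filtermap_ident)

text \<open>Every member of \<open>X\<close> is the image of its representative under some function,
  so \<open>X\<close> has at most as many elements as \<open>?S \<times> ?C\<close>. As
  \<open>?C\<close> has only continuum size, strictly below that of \<open>X\<close>, the
  representatives must be as many as \<open>X\<close>.\<close>

lemma nonisomorphic_representatives: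
  fixes X :: "nat filter set"
  assumes X: "|X| =o two_to_continuum"
  shows "\<exists>S\<subseteq>X. |S| =o two_to_continuum \<and>
    pairwise (\<lambda>U V. \<not> isomorphic_ultrafilters U V) S"
proof -
  \<comment> \<open>The chosen predicate depends only on the isomorphism class of \<open>U\<close>,
    so isomorphic filters receive equal representatives.\<close>
  define rep where "rep U = (SOME V. V \<in> X \<and> isomorphic_ultrafilters U V)" for U
  have rep: "rep U \<in> X" "isomorphic_ultrafilters U (rep U)" if "U \<in> X" for U
    using someI[of "\<lambda>V. V \<in> X \<and> isomorphic_ultrafilters U V" U] that
    by (simp_all add: rep_def isomorphic_ultrafilters_refl)
  have rep_eq: "rep U = rep V" if "isomorphic_ultrafilters U V" for U V
  proof -
    have "isomorphic_ultrafilters U W = isomorphic_ultrafilters V W" for W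
      using that isomorphic_ultrafilters_sym isomorphic_ultrafilters_trans by metis
    then show ?thesis by (simp add: rep_def)
  qed
  let ?S = "rep ` X" and ?C = "UNIV :: (nat \<Rightarrow> nat) set"
  have "pairwise (\<lambda>U V. \<not> isomorphic_ultrafilters U V) ?S"
  proof (rule pairwiseI, rule notI)
    fix U V assume "U \<in> ?S" "V \<in> ?S" "U \<noteq> V" and iso: "isomorphic_ultrafilters U V"
    then obtain U' V' where U': "U' \<in> X" "U = rep U'" and V': "V' \<in> X" "V = rep V'" by auto
    have "U = rep U" using rep_eq[OF rep(2)] U' by simp
    also have "\<dots> = rep V" using iso by (rule rep_eq)
    also have "\<dots> = V" using rep_eq[OF rep(2)[of V']] V' by simp
    finally show False using \<open>U \<noteq> V\<close> by simp
  qed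
  moreover have sub: "?S \<subseteq> X" using rep by blast
  moreover have "|X| \<le>o |?S|"
  proof -
    have "X \<subseteq> (\<lambda>(V, f). filtermap f V) ` (?S \<times> ?C)"
    proof
      fix U assume U: "U \<in> X"
      then obtain f where "U = filtermap f (rep U)"
        using isomorphic_ultrafilters_sym[OF rep(2)] unfolding isomorphic_ultrafilters_def by blast
      with U show "U \<in> (\<lambda>(V, f). filtermap f V) ` (?S \<times> ?C)"
        by (intro image_eqI[of _ _ "(rep U, f)"]) simp_all
    qed
    then have X_le: "|X| \<le>o |?S \<times> ?C|"
      by (rule ordLeq_transitive[OF card_of_mono1 card_of_image])
    have C_less: "|?C| <o |X|"
    proof -
      have "|UNIV :: (nat \<Rightarrow> bool) set| <o |UNIV :: (nat \<Rightarrow> bool) set set|"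
        using card_of_Pow[of "UNIV :: (nat \<Rightarrow> bool) set"] by simp
      moreover have "|UNIV :: (nat \<Rightarrow> bool) set set| =o two_to_continuum"
        unfolding two_to_continuum_eq
        by (rule card_of_ordIsoI, rule o_bij[of Collect "\<lambda>A x. x \<in> A"])
          (simp_all add: fun_eq_iff)
      ultimately have "|UNIV :: (nat \<Rightarrow> bool) set| <o two_to_continuum"
        by (rule ordLess_ordIso_trans)
      then have "|?C| <o two_to_continuum"
        using card_of_nat_fun by (simp add: continuum_eq ordIso_ordLess_trans)
      then show ?thesis using ordIso_symmetric[OF X] by (rule ordLess_ordIso_trans)
    qed
    have "infinite ?C"
    proof
      assume "finite ?C"
      then have "finite (range (\<lambda>f :: nat \<Rightarrow> nat. f 0))" by (rule finite_imageI)
      moreover have "range (\<lambda>f :: nat \<Rightarrow> nat. f 0) = UNIV"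
        by (rule surjI[of _ "\<lambda>n _. n"]) simp
      ultimately show False by simp
    qed
    show ?thesis
    proof (cases "|?S| \<le>o |?C|")
      case True
      have "|?S \<times> ?C| \<le>o |?C|"
        by (rule card_of_Times_ordLeq_infinite_Field)
          (simp_all add: Field_card_of \<open>infinite ?C\<close> True card_of_card_order_on
            card_of_mono1)
      then have "|X| \<le>o |?C|" by (rule ordLeq_transitive[OF X_le])
      then show ?thesis using C_less not_ordLess_ordLeq by blast
    next
      case False
      then have le: "|?C| \<le>o |?S|"
        using ordLeq_total[OF card_of_Well_order card_of_Well_order] by blast
      then have "infinite ?S" using card_of_ordLeq_infinite \<open>infinite ?C\<close> by blast
      then have "|?S \<times> ?C| \<le>o |?S|"
        using le by (intro card_of_Times_ordLeq_infinite_Field)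
          (simp_all add: Field_card_of card_of_card_order_on card_of_mono1)
      then show ?thesis by (rule ordLeq_transitive[OF X_le])
    qed
  qed
  ultimately have "|?S| =o |X|" by (simp add: ordIso_iff_ordLeq card_of_mono1)
  then have "|?S| =o two_to_continuum" using X by (rule ordIso_transitive)
  then show ?thesis using sub \<open>pairwise _ ?S\<close> by blast
qed

section \<open>P-points from dense requirements\<close>

context largeness
begin

text \<open>\<open>E\<close> is a further requirement beside the P-point dichotomy. Positivity of
  all members serves to refute properties, the sets satisfying \<open>E\<close> serve to establish
  them.\<close>

theorem many_p_points:
  fixes E :: "(nat \<Rightarrow> nat) \<Rightarrow> nat set \<Rightarrow> bool"
  assumes CH: Continuum_Hypothesis
    and E: "\<And>f A. pos A \<Longrightarrow> \<exists>B\<subseteq>A. pos B \<and> E f B"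
  shows "\<exists>S. |S| =o two_to_continuum \<and>
    (\<forall>U\<in>S. p_point U \<and> (\<forall>A. (\<forall>\<^sub>F n in U. n \<in> A) \<longrightarrow> pos A) \<and>
      (\<forall>f. \<exists>A. (\<forall>\<^sub>F n in U. n \<in> A) \<and> E f A)) \<and>
    pairwise (\<lambda>U V. \<not> isomorphic_ultrafilters U V) S"
proof -
  define D where "D f A \<longleftrightarrow> constant_or_finite_to_one f A \<and> E f A" for f A
  interpret dense_requirements L D
  proof
    fix A f assume "pos A"
    then obtain B where B: "B \<subseteq> A" "pos B" "constant_or_finite_to_one f B"
      using pos_constant_or_finite_to_one by metis
    \<comment> \<open>The dichotomy passes to subsets, while \<open>E\<close> is not assumed to, so
      \<open>E\<close> is met last.\<close>
    obtain C where C: "C \<subseteq> B" "pos C" "E f C" using E[OF B(2)] by metis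
    have "D f C" using constant_or_finite_to_one_subset[OF B(3) C(1)] C(3) by (simp add: D_def)
    then show "\<exists>B\<subseteq>A. pos B \<and> D f B" using B C by (meson order_trans)
  qed
  let ?T = "tower_filter"
  note pos = eventually_tower_filter_pos[OF CH]
  have dich: "constant_or_finite_to_one f (tower h f)" and E': "E f (tower h f)" for f h
    using tower(2)[OF CH, where h = h and f = f] by (simp_all add: D_def)
  have ultra: "nonprincipal_ultrafilter (?T h)" for h
    unfolding nonprincipal_ultrafilter_def ultrafilter_def
  proof (intro conjI allI)
    show "?T h \<noteq> bot" by (rule tower_filter_not_bot[OF CH])
    show "?T h \<noteq> principal {a}" for a
    proof
      assume "?T h = principal {a}"
      then have "\<forall>\<^sub>F n in ?T h. n \<in> {a}" by (simp add: eventually_principal)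
      then have "pos {a}" by (rule pos)
      then show False using pos_infinite by blast
    qed
    fix P :: "nat \<Rightarrow> bool"
    \<comment> \<open>The dichotomy for the indicator function of \<open>P\<close> decides
      \<open>P\<close>: with only two values, it cannot be finite-to-one on an infinite stage, so it
      is constant there.\<close>
    define f :: "nat \<Rightarrow> nat" where "f n = of_bool (P n)" for n
    let ?A = "tower h f"
    have inf: "infinite ?A" using tower(1)[OF CH] by (rule pos_infinite)
    have "\<exists>c. \<forall>n\<in>?A. f n = c"
    proof (rule ccontr)
      assume "\<not> (\<exists>c. \<forall>n\<in>?A. f n = c)"
      then have "finite {n \<in> ?A. f n = k}" for k
        using dich[of f h] unfolding constant_or_finite_to_one_def by blast
      then have "finite ({n \<in> ?A. f n = 0} \<union> {n \<in> ?A. f n = 1})" by (intro finite_UnI)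
      moreover have "?A \<subseteq> {n \<in> ?A. f n = 0} \<union> {n \<in> ?A. f n = 1}"
        by (auto simp: f_def)
      ultimately show False using inf finite_subset by blast
    qed
    then obtain c where c: "\<And>n. n \<in> ?A \<Longrightarrow> f n = c" by blast
    have ev: "\<forall>\<^sub>F n in ?T h. f n = c"
      using eventually_tower[OF CH, where h = h and f = f] by (rule eventually_mono) (rule c)
    show "(\<forall>\<^sub>F n in ?T h. P n) \<or> (\<forall>\<^sub>F n in ?T h. \<not> P n)"
    proof (cases "c = 0")
      case True
      have "\<forall>\<^sub>F n in ?T h. \<not> P n"
        using ev by (rule eventually_mono) (simp add: f_def True split: if_splits)
      then show ?thesis by simp
    next
      case False
      have "\<forall>\<^sub>F n in ?T h. P n"
        using ev by (rule eventually_mono) (use False in \<open>auto simp: f_def of_bool_def split: if_splits\<close>)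
      then show ?thesis by simp
    qed
  qed
  have pp: "p_point (?T h)" for h
    unfolding p_point_def
    using ultra eventually_tower[OF CH] dich[unfolded constant_or_finite_to_one_def] by blast
  have "|range ?T| =o two_to_continuum"
  proof -
    \<comment> \<open>Branches are predicates on functions, whereas \<open>two_to_continuum\<close>
      counts predicates on \<open>nat \<Rightarrow> bool\<close>; \<open>\<phi>\<close> translates
      between them.\<close>
    obtain \<phi> :: "(nat \<Rightarrow> nat) \<Rightarrow> nat \<Rightarrow> bool" where \<phi>: "bij \<phi>"
      using card_of_nat_fun unfolding continuum_eq card_of_ordIso[symmetric] by blast
    have "bij_betw (\<lambda>k. ?T (k \<circ> \<phi>)) UNIV (range ?T)"
    proof (rule bij_betw_imageI)
      show "inj (\<lambda>k. ?T (k \<circ> \<phi>))"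
      proof (rule injI)
        fix k k' assume "?T (k \<circ> \<phi>) = ?T (k' \<circ> \<phi>)"
        then have "k \<circ> \<phi> = k' \<circ> \<phi>" using inj_tower_filter[OF CH] by (simp add: inj_eq)
        then show "k = k'" using \<phi> by (metis bij_is_surj fun.map_comp surj_iff comp_id)
      qed
      have "?T h \<in> range (\<lambda>k. ?T (k \<circ> \<phi>))" for h
        using \<phi> by (intro image_eqI[of _ _ "h \<circ> inv \<phi>"]) (simp_all add: comp_assoc bij_is_inj)
      then show "range (\<lambda>k. ?T (k \<circ> \<phi>)) = range ?T" by auto
    qed
    then have "|UNIV :: ((nat \<Rightarrow> bool) \<Rightarrow> bool) set| =o |range ?T|" by (rule card_of_ordIsoI)
    then show ?thesis unfolding two_to_continuum_eq by (rule ordIso_symmetric)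
  qed
  then obtain S where S: "S \<subseteq> range ?T" "|S| =o two_to_continuum"
      "pairwise (\<lambda>U V. \<not> isomorphic_ultrafilters U V) S"
    using nonisomorphic_representatives by metis
  have "\<forall>U\<in>S. p_point U \<and> (\<forall>A. (\<forall>\<^sub>F n in U. n \<in> A) \<longrightarrow> pos A) \<and>
      (\<forall>f. \<exists>A. (\<forall>\<^sub>F n in U. n \<in> A) \<and> E f A)"
  proof
    fix U assume U: "U \<in> S"
    obtain h where "U = ?T h" using U S(1) by auto
    then show "p_point U \<and> (\<forall>A. (\<forall>\<^sub>F n in U. n \<in> A) \<longrightarrow> pos A) \<and>
        (\<forall>f. \<exists>A. (\<forall>\<^sub>F n in U. n \<in> A) \<and> E f A)"
      using pp pos E' eventually_tower[OF CH] by metis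
  qed
  then show ?thesis using S(2,3) by (intro exI[of _ S] conjI)
qed

end

section \<open>P-points that are not quasi-selective\<close>

definition block :: "(nat \<Rightarrow> nat) \<Rightarrow> nat \<Rightarrow> nat set" where
  "block e k = {e k..<e (Suc k)}"

text \<open>Below \<^term>\<open>e 0\<close> there is no block; there \<open>block_end e n = e 0\<close>.\<close>

definition block_end :: "(nat \<Rightarrow> nat) \<Rightarrow> nat \<Rightarrow> nat" where
  "block_end e n = (LEAST m. n < m \<and> m \<in> range e)"

text \<open>The reflection of each block, shifted to count down to 0 at the last point. Its values
  stay below the length of the block; a dyadic block is as long as its least element, which gives
  \<open>flip_dyadic_le\<close>.\<close>

definition flip :: "(nat \<Rightarrow> nat) \<Rightarrow> nat \<Rightarrow> nat" where
  "flip e n = block_end e n - 1 - n"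

lemma block_end_eq:
  assumes "strict_mono e" "n \<in> block e k"
  shows "block_end e n = e (Suc k)"
  unfolding block_end_def
proof (rule Least_equality)
  show "n < e (Suc k) \<and> e (Suc k) \<in> range e" using assms(2) by (simp add: block_def)
  fix m assume "n < m \<and> m \<in> range e"
  then obtain j where j: "m = e j" "n < e j" by auto
  then have "e k < e j" using assms(2) by (simp add: block_def)
  then have "Suc k \<le> j" using assms(1) by (simp add: strict_mono_less)
  then show "e (Suc k) \<le> m" using assms(1) j by (simp add: strict_mono_less_eq)
qed

lemma card_block_flip_mono:
  assumes "strict_mono e" "F \<subseteq> block e k" "mono g" "\<And>n. n \<in> F \<Longrightarrow> flip e n = g n"
  shows "card F \<le> 1"
proof -
  have less: False if "x \<in> F" "y \<in> F" "x < y" for x y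
  proof -
    \<comment> \<open>The bound on \<open>y\<close> keeps the truncated subtraction strictly
      decreasing.\<close>
    have "flip e x = e (Suc k) - 1 - x" "flip e y = e (Suc k) - 1 - y" "y < e (Suc k)"
      using that assms(2) block_end_eq[OF assms(1), of _ k]
      by (auto simp: flip_def block_def subset_eq)
    then have "flip e y < flip e x" using that by linarith
    moreover have "g x \<le> g y" using assms(3) that by (simp add: monoD)
    ultimately show False using assms(4) that by simp
  qed
  then have "x = y" if "x \<in> F" "y \<in> F" for x y using that by (meson linorder_neqE_nat)
  moreover have "finite F" using assms(2) by (rule finite_subset) (simp add: block_def)
  ultimately show ?thesis by (simp add: card_le_Suc0_iff_eq)
qed

text \<open>Level 0 suffices: it provides two points of one block, where \<open>flip\<close>
  strictly decreases.\<close>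

lemma (in largeness) not_pos_flip_mono:
  assumes "strict_mono e" "\<And>F. L 0 F \<Longrightarrow> \<exists>k. F \<subseteq> block e k" "mono g"
  shows "\<not> pos {n. flip e n = g n}"
proof
  assume "pos {n. flip e n = g n}"
  then obtain F where F: "F \<subseteq> {n. flip e n = g n}" "L 0 F" unfolding pos_def by blast
  obtain k where "F \<subseteq> block e k" using assms(2) F(2) by blast
  then have "card F \<le> 1" using assms F by (intro card_block_flip_mono[of e F k g]) auto
  then show False using large_0[OF F(2)] by simp
qed

text \<open>The threshold doubles with the level, so the bigger part of a split loses just one
  level; it starts at two points.\<close>

definition large_in_dyadic_block :: "nat \<Rightarrow> nat set \<Rightarrow> bool" where
  "large_in_dyadic_block n F \<longleftrightarrow> (\<exists>k. F \<subseteq> block ((^) 2) k) \<and> 2 ^ Suc n \<le> card F"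

lemma largeness_dyadic: "largeness large_in_dyadic_block"
proof
  show fin: "finite F" if "large_in_dyadic_block n F" for n F
    using that unfolding large_in_dyadic_block_def block_def
    by (meson finite_atLeastLessThan finite_subset)
  show "\<exists>G\<subseteq>F. large_in_dyadic_block n G \<and> (G \<subseteq> B \<or> G \<inter> B = {})"
    if F: "large_in_dyadic_block (Suc n) F" for n F B
  proof -
    obtain k where k: "F \<subseteq> block ((^) 2) k" and card: "2 ^ Suc (Suc n) \<le> card F"
      using F unfolding large_in_dyadic_block_def by blast
    have "card F = card (F \<inter> B) + card (F - B)"
      using fin[OF F] by (rule card_Int_Diff)
    then consider "2 ^ Suc n \<le> card (F \<inter> B)" | "2 ^ Suc n \<le> card (F - B)"
      using card by fastforce
    then show ?thesis
    proof cases
      case 1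
      then have "large_in_dyadic_block n (F \<inter> B)"
        using k unfolding large_in_dyadic_block_def by blast
      then show ?thesis by blast
    next
      case 2
      then have "large_in_dyadic_block n (F - B)"
        using k unfolding large_in_dyadic_block_def by blast
      then show ?thesis by blast
    qed
  qed
  show "2 \<le> card F" if "large_in_dyadic_block 0 F" for F
    using that by (simp add: large_in_dyadic_block_def)
  \<comment> \<open>The block of index \<open>Suc n\<close> has exactly \<open>2 ^ Suc n\<close>
    points.\<close>
  show "\<exists>F. large_in_dyadic_block n F" for n
    unfolding large_in_dyadic_block_def
    by (intro exI[of _ "block ((^) 2) (Suc n)"] conjI exI[of _ "Suc n"]) (simp_all add: block_def)
qed

lemma strict_mono_power2: "strict_mono ((^) (2::nat))"
  by (simp add: strict_mono_def)

lemma flip_dyadic_le: "flip ((^) 2) n \<le> n"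
proof (cases "n = 0")
  case True
  \<comment> \<open>The point 0 lies before the first dyadic block, which starts at 1.\<close>
  have "block_end ((^) 2) 0 \<le> 1"
    unfolding block_end_def by (rule Least_le) (auto intro: range_eqI[of _ _ 0])
  then show ?thesis using True by (simp add: flip_def)
next
  case False
  then obtain k where k: "2 ^ k \<le> n" "n < 2 ^ (k + 1)"
    using ex_power_ivl1[of 2 n] by auto
  then have "block_end ((^) 2) n = 2 ^ Suc k"
    by (intro block_end_eq strict_mono_power2) (simp add: block_def)
  then show ?thesis using k by (simp add: flip_def)
qed

text \<open>With a trivial \<open>E\<close>, quasi-selectivity fails through positivity alone: the
  dyadic \<open>flip\<close> is a test function below the identity.\<close>

theorem many_p_points_not_quasi_selective:
  assumes CH: Continuum_Hypothesis
  shows "\<exists>S. |S| =o two_to_continuum \<and> (\<forall>U\<in>S. p_point U \<and> \<not> quasi_selective U) \<and>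
    pairwise (\<lambda>U V. \<not> isomorphic_ultrafilters U V) S"
proof -
  interpret largeness large_in_dyadic_block by (rule largeness_dyadic)
  obtain S where S: "|S| =o two_to_continuum" "pairwise (\<lambda>U V. \<not> isomorphic_ultrafilters U V) S"
    and U': "\<forall>U\<in>S. p_point U \<and> (\<forall>A. (\<forall>\<^sub>F n in U. n \<in> A) \<longrightarrow> pos A) \<and>
      (\<forall>f :: nat \<Rightarrow> nat. \<exists>A. (\<forall>\<^sub>F n in U. n \<in> A) \<and> True)"
    using many_p_points[OF CH, of "\<lambda>_ _. True"] by auto
  then have U: "\<And>U. U \<in> S \<Longrightarrow> p_point U"
      "\<And>U A. U \<in> S \<Longrightarrow> \<forall>\<^sub>F n in U. n \<in> A \<Longrightarrow> pos A"
    by simp_all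
  have "\<not> quasi_selective V" if V: "V \<in> S" for V
  proof
    assume "quasi_selective V"
    then obtain g where g: "mono g" "\<forall>\<^sub>F n in V. flip ((^) 2) n = g n"
      unfolding quasi_selective_def using flip_dyadic_le by blast
    then have "pos {n. flip ((^) 2) n = g n}" by (intro U(2)[OF V]) simp
    moreover have "\<not> pos {n. flip ((^) 2) n = g n}"
      by (rule not_pos_flip_mono[OF strict_mono_power2 _ g(1)])
        (simp add: large_in_dyadic_block_def)
    ultimately show False by simp
  qed
  then show ?thesis using S U(1) by blast
qed

section \<open>Quasi-selective ultrafilters that are not selective\<close>

text \<open>Infinite index sets are thinned one coordinate at a time: by the pigeonhole principle,
  coordinate \<open>n\<close> is constant on \<open>S (Suc n)\<close>. The limit \<open>v\<close>
  thus agrees on each initial segment with arbitrarily late rows.\<close>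

lemma koenig:
  fixes w :: "nat \<Rightarrow> nat \<Rightarrow> 'b"
  assumes fin: "\<And>x. finite (range (\<lambda>N. w N x))"
  shows "\<exists>v. \<forall>M. \<exists>N\<ge>M. \<forall>x<M. w N x = v x"
proof -
  have "\<exists>S. \<forall>n. infinite (S n) \<and> (S (Suc n) \<subseteq> S n \<and> (\<exists>c. \<forall>N\<in>S (Suc n). w N n = c))"
  proof (rule dependent_nat_choice)
    show "\<exists>S::nat set. infinite S" by (rule exI[of _ UNIV]) simp
    fix S :: "nat set" and n assume S: "infinite S"
    have "finite ((\<lambda>N. w N n) ` S)" using fin[of n] by (rule rev_finite_subset) auto
    from pigeonhole_infinite[OF S this] obtain a where "infinite {N \<in> S. w N n = w a n}" by blast
    then show "\<exists>T. infinite T \<and> (T \<subseteq> S \<and> (\<exists>c. \<forall>N\<in>T. w N n = c))"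
      by (intro exI[of _ "{N \<in> S. w N n = w a n}"]) auto
  qed
  then obtain S where S: "\<And>n. infinite (S n)" "\<And>n. S (Suc n) \<subseteq> S n"
      and "\<And>n. \<exists>c. \<forall>N\<in>S (Suc n). w N n = c"
    by blast
  then obtain v where v: "\<And>n N. N \<in> S (Suc n) \<Longrightarrow> w N n = v n" by metis
  have "\<exists>N\<ge>M. \<forall>x<M. w N x = v x" for M
  proof -
    obtain N where N: "N \<ge> M" "N \<in> S M"
      using S(1)[of M] by (auto simp: infinite_nat_iff_unbounded_le)
    have "N \<in> S (Suc x)" if "x < M" for x
      using lift_Suc_antimono_le[of S, OF S(2), of "Suc x" M] that N by auto
    then show ?thesis using N v by blast
  qed
  then show ?thesis by blast
qed

text \<open>From a monotone subsequence. In the nonincreasing case the values are bounded by the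
  first one, so one value recurs infinitely often.\<close>

lemma infinite_nondecreasing_subset:
  fixes f :: "nat \<Rightarrow> nat"
  assumes "infinite X"
  shows "\<exists>Y\<subseteq>X. infinite Y \<and> mono_on Y f"
proof -
  obtain r where r: "strict_mono r" "monoseq (\<lambda>n. f (enumerate X (r n)))"
    using seq_monosub[of "\<lambda>n. f (enumerate X n)"] by blast
  define s where "s n = enumerate X (r n)" for n
  have s: "strict_mono s"
    using strict_mono_enumerate[OF assms] r(1) by (simp add: s_def strict_mono_def)
  let ?Y = "range s"
  have Y: "?Y \<subseteq> X" "infinite ?Y"
    using enumerate_in_set[OF assms] range_inj_infinite[OF strict_mono_imp_inj_on[OF s]]
    by (auto simp: s_def)
  from r(2) consider "incseq (\<lambda>n. f (s n))" | "decseq (\<lambda>n. f (s n))"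
    by (auto simp: monoseq_iff s_def)
  then show ?thesis
  proof cases
    case 1
    have "mono_on ?Y f"
    proof (rule mono_onI)
      fix x y assume "x \<in> ?Y" "y \<in> ?Y" "x \<le> y"
      then obtain m n where "x = s m" "y = s n" "s m \<le> s n" by auto
      then show "f x \<le> f y" using 1 by (simp add: strict_mono_less_eq[OF s] incseq_def)
    qed
    then show ?thesis using Y by blast
  next
    case 2
    have "f ` ?Y \<subseteq> {..f (s 0)}" using 2 by (auto simp: decseq_def)
    then have "finite (f ` ?Y)" by (rule finite_subset) simp
    from pigeonhole_infinite[OF Y(2) this] obtain a where "infinite {y \<in> ?Y. f y = f a}" by blast
    then show ?thesis
      using Y(1) by (intro exI[of _ "{y \<in> ?Y. f y = f a}"]) (auto intro: mono_onI)
  qed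
qed

text \<open>The level counts how many rounds a set survives when each round imposes a partition and
  a function below the identity together, and the set may shrink in response.\<close>

primrec large :: "nat \<Rightarrow> nat set \<Rightarrow> bool" where
  "large 0 F \<longleftrightarrow> finite F \<and> 2 \<le> card F"
| "large (Suc n) F \<longleftrightarrow> finite F \<and> (\<forall>B f. (\<forall>x. f x \<le> x) \<longrightarrow>
     (\<exists>G\<subseteq>F. large n G \<and> (G \<subseteq> B \<or> G \<inter> B = {}) \<and> mono_on G f))"

lemma large_imp_finite: "large n F \<Longrightarrow> finite F"
  by (cases n) simp_all

text \<open>
  Compactness: if no finite initial segment of \<open>X\<close> were large, then, because \<open>f x \<le> x\<close> leaves
  finitely many values at each point, the counterexamples would converge to a pair \<open>(B, f)\<close>
  on all of \<open>X\<close>.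
\<close>

lemma infinite_has_large_subset: "infinite X \<Longrightarrow> \<exists>F\<subseteq>X. large n F"
proof (induction n arbitrary: X)
  case 0
  then show ?case using infinite_arbitrarily_large[of X 2] by auto
next
  case (Suc n)
  define bad where "bad N B f \<longleftrightarrow> (\<forall>x. f x \<le> x) \<and>
    (\<forall>G\<subseteq>X \<inter> {..<N}. large n G \<and> (G \<subseteq> B \<or> G \<inter> B = {}) \<longrightarrow> \<not> mono_on G f)" for N B f
  show ?case
  proof (rule ccontr)
    assume "\<not> (\<exists>F\<subseteq>X. large (Suc n) F)"
    then have no_large: "\<not> large (Suc n) (X \<inter> {..<N})" for N by blast
    have "\<exists>B f. bad N B f" for N
    proof -
      have "finite (X \<inter> {..<N})" by simp
      with no_large[of N] obtain B f where "\<forall>x. f x \<le> x" and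
        "\<not> (\<exists>G\<subseteq>X \<inter> {..<N}. large n G \<and> (G \<subseteq> B \<or> G \<inter> B = {}) \<and> mono_on G f)"
        unfolding large.simps by metis
      then have "bad N B f" unfolding bad_def by meson
      then show ?thesis by blast
    qed
    then obtain B f where bad: "\<And>N. bad N (B N) (f N)" by metis
    define w where "w N x = (f N x, x \<in> B N)" for N x
    have "\<exists>v. \<forall>M. \<exists>N\<ge>M. \<forall>x<M. w N x = v x"
    proof (rule koenig)
      fix x
      have "range (\<lambda>N. w N x) \<subseteq> {..x} \<times> UNIV" using bad by (auto simp: w_def bad_def)
      then show "finite (range (\<lambda>N. w N x))" by (rule finite_subset) simp
    qed
    then obtain v where v: "\<And>M. \<exists>N\<ge>M. \<forall>x<M. w N x = v x" by blast
    let ?f = "\<lambda>x. fst (v x)" and ?B = "{x. snd (v x)}"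
    \<comment> \<open>An infinite subset of \<open>X\<close> homogeneous for the limit pair contains
      an \<open>n\<close>-large \<open>G\<close> by the induction hypothesis. A counterexample late
      enough to agree with the limit on \<open>G\<close>, and whose segment includes
      \<open>G\<close>, is refuted by \<open>G\<close>.\<close>
    obtain Y where Y: "Y \<subseteq> X" "infinite Y" "Y \<subseteq> ?B \<or> Y \<inter> ?B = {}"
    proof (cases "finite (X \<inter> ?B)")
      case True
      then have "infinite (X - X \<inter> ?B)" using Suc.prems by (rule Diff_infinite_finite)
      then show ?thesis by (intro that[of "X - X \<inter> ?B"]) auto
    next
      case False
      then show ?thesis by (intro that[of "X \<inter> ?B"]) auto
    qed
    obtain Z where Z: "Z \<subseteq> Y" "infinite Z" "mono_on Z ?f"
      using infinite_nondecreasing_subset[OF Y(2)] by metis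
    obtain G where G: "G \<subseteq> Z" "large n G" using Suc.IH[OF Z(2)] by metis
    obtain M where M: "\<And>x. x \<in> G \<Longrightarrow> x < M"
      using large_imp_finite[OF G(2)] unfolding finite_nat_set_iff_bounded by metis
    obtain N where N: "N \<ge> M" "\<And>x. x < M \<Longrightarrow> w N x = v x" using v[of M] by metis
    have eq: "?f x = f N x" "x \<in> ?B \<longleftrightarrow> x \<in> B N" if "x \<in> G" for x
      using N(2)[OF M[OF that], symmetric] by (simp_all add: w_def)
    have "G \<subseteq> X \<inter> {..<N}"
    proof
      fix x assume x: "x \<in> G"
      then have "x < N" using M[OF x] N(1) by linarith
      then show "x \<in> X \<inter> {..<N}" using x G Z Y by auto
    qed
    moreover have "G \<subseteq> B N \<or> G \<inter> B N = {}" 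
    proof (use Y(3) in \<open>elim disjE\<close>)
      assume "Y \<subseteq> ?B"
      then have "G \<subseteq> B N" using Z(1) G(1) eq(2) by auto
      then show ?thesis ..
    next
      assume "Y \<inter> ?B = {}"
      then have "G \<inter> B N = {}" using Z(1) G(1) eq(2) by auto
      then show ?thesis ..
    qed
    moreover have "mono_on G (f N)"
    proof (rule mono_onI)
      fix x y assume xy: "x \<in> G" "y \<in> G" "x \<le> y"
      then have "?f x \<le> ?f y" using G(1) by (intro mono_onD[OF Z(3)]) auto
      then show "f N x \<le> f N y" using eq xy by simp
    qed
    ultimately show False using bad[of N] G(2) unfolding bad_def by simp
  qed
qed

lemma mono_on_extend:
  fixes f :: "nat \<Rightarrow> nat"
  assumes "mono_on A f"
  shows "\<exists>g. mono g \<and> (\<forall>n\<in>A. f n = g n)"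
proof -
  \<comment> \<open>The running maximum of \<open>f\<close> along \<open>A\<close>, with 0 as the
    value before the first element of \<open>A\<close>.\<close>
  define g where "g n = Max (insert 0 (f ` (A \<inter> {..n})))" for n
  have "mono g" unfolding g_def by (intro monoI Max_mono) auto
  moreover have "g n = f n" if "n \<in> A" for n
    unfolding g_def by (rule Max_eqI) (use that assms in \<open>auto dest: mono_onD\<close>)
  ultimately show ?thesis by metis
qed

section \<open>Largeness within the blocks of a sparse partition\<close>

locale block_large =
  fixes e :: "nat \<Rightarrow> nat"
  assumes e: "strict_mono e" and block_large: "\<And>k. \<exists>F\<subseteq>block e k. large k F"
begin

definition L :: "nat \<Rightarrow> nat set \<Rightarrow> bool" where
  "L n F \<longleftrightarrow> (\<exists>k. F \<subseteq> block e k) \<and> large n F"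

lemma L_Suc:
  assumes "L (Suc n) F" "\<And>x. f x \<le> x"
  shows "\<exists>G\<subseteq>F. L n G \<and> (G \<subseteq> B \<or> G \<inter> B = {}) \<and> mono_on G f"
proof -
  have "large (Suc n) F" using assms(1) by (simp add: L_def)
  then have "\<exists>G\<subseteq>F. large n G \<and> (G \<subseteq> B \<or> G \<inter> B = {}) \<and> mono_on G f"
    unfolding large.simps using assms(2) by blast
  then obtain G where "G \<subseteq> F" "large n G" "G \<subseteq> B \<or> G \<inter> B = {}" "mono_on G f" by blast
  moreover obtain k where "F \<subseteq> block e k" using assms(1) by (auto simp: L_def)
  ultimately show ?thesis unfolding L_def by (meson order_trans)
qed

sublocale largeness L
proof
  show "finite F" if "L n F" for n F using that large_imp_finite by (auto simp: L_def)
  \<comment> \<open>Plain splitting is the case of the constant function 0, which lies below the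
    identity.\<close>
  show "\<exists>G\<subseteq>F. L n G \<and> (G \<subseteq> B \<or> G \<inter> B = {})" if "L (Suc n) F" for n F B
    using L_Suc[OF that, of "\<lambda>_. 0" B] by auto
  show "2 \<le> card F" if "L 0 F" for F using that by (simp add: L_def)
  show "\<exists>F. L n F" for n using block_large[of n] by (auto simp: L_def)
qed

text \<open>If \<open>f\<close> is finite-to-one on \<open>B\<close>, it tends to infinity along
  \<open>B\<close>. Large pieces on which \<open>f\<close> is nondecreasing, spaced so far apart
  that \<open>f\<close> on later pieces dominates its earlier values, have a union on which
  \<open>f\<close> is nondecreasing.\<close>

lemma pos_mono_on:
  assumes A: "pos A" and f: "\<And>x. f x \<le> x"
  shows "\<exists>B\<subseteq>A. pos B \<and> mono_on B f"
proof -
  obtain B where B: "B \<subseteq> A" "pos B" "constant_or_finite_to_one f B"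
    using pos_constant_or_finite_to_one[OF A] by metis
  from B(3) show ?thesis
    unfolding constant_or_finite_to_one_def
  proof
    assume "\<exists>c. \<forall>n\<in>B. f n = c"
    then have "mono_on B f" by (auto intro: mono_onI)
    then show ?thesis using B by blast
  next
    assume fin: "\<forall>k. finite {n \<in> B. f n = k}"
    \<comment> \<open>The demand \<open>t > x\<close> makes the spacing also put the pieces in
      increasing order, which excludes the last case of the final comparison.\<close>
    have "\<exists>t>x. \<forall>z\<in>B. t \<le> z \<longrightarrow> f x \<le> f z" for x
    proof -
      have "finite (\<Union>k<f x. {n \<in> B. f n = k})" using fin by simp
      then obtain m where m: "\<And>z. z \<in> (\<Union>k<f x. {n \<in> B. f n = k}) \<Longrightarrow> z < m"
        unfolding finite_nat_set_iff_bounded by metis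
      have "f x \<le> f z" if "z \<in> B" "max m (Suc x) \<le> z" for z
      proof (rule ccontr)
        assume "\<not> f x \<le> f z"
        then have "z < m" using that by (intro m) auto
        then show False using that by simp
      qed
      then show ?thesis by (intro exI[of _ "max m (Suc x)"]) auto
    qed
    then obtain t where t: "\<And>x. x < t x" "\<And>x z. z \<in> B \<Longrightarrow> t x \<le> z \<Longrightarrow> f x \<le> f z"
      by metis
    define Q where "Q n F \<longleftrightarrow> F \<subseteq> B \<and> L n F \<and> mono_on F f" for n F
    have "\<exists>F. finite F \<and> F \<subseteq> {m..} \<and> Q n F" for n m
    proof -
      \<comment> \<open>The extra level pays for making \<open>f\<close> nondecreasing on the piece;
        the partition used with it is the trivial one given by \<open>UNIV\<close>.\<close>
      obtain F where F: "F \<subseteq> B" "L (Suc n) F" "F \<subseteq> {m..}"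
        using pos_large_above[OF B(2)] by metis
      obtain G where G: "G \<subseteq> F" "L n G" "mono_on G f" using L_Suc[OF F(2) f, of UNIV] by blast
      have "finite G" using G(2) by (rule large_finite)
      moreover have "G \<subseteq> {m..}" "Q n G" using F G by (auto simp: Q_def)
      ultimately show ?thesis by (intro exI[of _ G] conjI)
    qed
    from finite_sequence_choice[of Q t, OF this] obtain F
      where F: "\<forall>n. finite (F n) \<and> Q n (F n) \<and> (\<forall>m<n. \<forall>x\<in>F m. \<forall>y\<in>F n. t x \<le> y)"
      by (elim exE) (rule that)
    have Q: "F n \<subseteq> B" "L n (F n)" "mono_on (F n) f" for n using F by (simp_all add: Q_def)
    have less: "t x \<le> y" if "m < n" "x \<in> F m" "y \<in> F n" for m n x y using F that by simp
    let ?C = "\<Union>n. F n"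
    have "pos ?C" by (rule pos_if_unbounded) (use Q(2) in blast)
    moreover have "mono_on ?C f"
    proof (rule mono_onI)
      fix x y assume "x \<in> ?C" "y \<in> ?C" and xy: "x \<le> y"
      then obtain m n where mn: "x \<in> F m" "y \<in> F n" by auto
      consider "m < n" | "m = n" | "n < m" by linarith
      then show "f x \<le> f y"
      proof cases
        case 1
        then show ?thesis using less[OF 1 mn] t(2) Q(1) mn(2) by blast
      next
        case 2
        then show ?thesis using mono_onD[OF Q(3)] mn xy by blast
      next
        case 3
        then show ?thesis using less[OF 3 mn(2,1)] t(1)[of y] xy by linarith
      qed
    qed
    moreover have "?C \<subseteq> A" using Q(1) B(1) by blast
    ultimately show ?thesis by blast
  qed
qed

theorem many_quasi_selective:
  assumes CH: Continuum_Hypothesis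
  shows "\<exists>S. |S| =o two_to_continuum \<and> (\<forall>U\<in>S. quasi_selective U \<and> \<not> selective U) \<and>
    pairwise (\<lambda>U V. \<not> isomorphic_ultrafilters U V) S"
proof -
  \<comment> \<open>Vacuous for functions not below the identity, so that every function indexes a
    requirement that can be met.\<close>
  define E where "E f B \<longleftrightarrow> (\<forall>x. f x \<le> x) \<longrightarrow> mono_on B f" for f :: "nat \<Rightarrow> nat" and B
  have E: "\<exists>B\<subseteq>A. pos B \<and> E f B" if "pos A" for A f
  proof (cases "\<forall>x. f x \<le> x")
    case True
    then show ?thesis using pos_mono_on[OF that, of f] by (auto simp: E_def)
  next
    case False
    then show ?thesis using that by (intro exI[of _ A]) (auto simp: E_def)
  qed
  have "\<exists>S. |S| =o two_to_continuum \<and>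
    (\<forall>U\<in>S. p_point U \<and> (\<forall>A. (\<forall>\<^sub>F n in U. n \<in> A) \<longrightarrow> pos A) \<and>
      (\<forall>f. \<exists>A. (\<forall>\<^sub>F n in U. n \<in> A) \<and> E f A)) \<and>
    pairwise (\<lambda>U V. \<not> isomorphic_ultrafilters U V) S"
    by (rule many_p_points[OF CH E])
  then obtain S
    where S: "|S| =o two_to_continuum" "pairwise (\<lambda>U V. \<not> isomorphic_ultrafilters U V) S"
    and U': "\<forall>U\<in>S. p_point U \<and> (\<forall>A. (\<forall>\<^sub>F n in U. n \<in> A) \<longrightarrow> pos A) \<and>
      (\<forall>f. \<exists>A. (\<forall>\<^sub>F n in U. n \<in> A) \<and> E f A)"
    by (elim exE conjE) (rule that)
  then have U: "\<And>U. U \<in> S \<Longrightarrow> p_point U"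
      "\<And>U A. U \<in> S \<Longrightarrow> \<forall>\<^sub>F n in U. n \<in> A \<Longrightarrow> pos A"
      "\<And>U f. U \<in> S \<Longrightarrow> \<exists>A. (\<forall>\<^sub>F n in U. n \<in> A) \<and> E f A"
    by simp_all
  have "quasi_selective V \<and> \<not> selective V" if V: "V \<in> S" for V
  proof
    show "quasi_selective V"
      unfolding quasi_selective_def
    proof (intro conjI allI impI)
      show "nonprincipal_ultrafilter V" using U(1)[OF V] by (simp add: p_point_def)
      fix f :: "nat \<Rightarrow> nat" assume f: "\<forall>n. f n \<le> n"
      obtain A where A: "\<forall>\<^sub>F n in V. n \<in> A" "E f A" using U(3)[OF V] by metis
      then have "mono_on A f" using f by (simp add: E_def)
      then obtain g where g: "mono g" "\<forall>n\<in>A. f n = g n" using mono_on_extend by metis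
      have "\<forall>\<^sub>F n in V. f n = g n" using A(1) by (rule eventually_mono) (use g(2) in simp)
      then show "\<exists>g. mono g \<and> (\<forall>\<^sub>F n in V. f n = g n)" using g(1) by blast
    qed
    show "\<not> selective V"
    proof
      assume "selective V"
      then obtain g where g: "mono g" "\<forall>\<^sub>F n in V. flip e n = g n"
        unfolding selective_def by metis
      then have "pos {n. flip e n = g n}" by (intro U(2)[OF V]) simp
      moreover have "\<not> pos {n. flip e n = g n}"
        by (rule not_pos_flip_mono[OF e _ g(1)]) (simp add: L_def)
      ultimately show False by simp
    qed
  qed
  then show ?thesis using S by blast
qed

end

text \<open>Each block is made long enough to contain a finite large subset of the infinite set of
  all points from its left end on.\<close>

lemma block_large_exists: "\<exists>e. block_large e"
proof -
  \<comment> \<open>The conjunct \<open>True\<close> stands for the invariant in the shape of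
    \<open>dependent_nat_choice\<close>.\<close>
  have "\<exists>e. \<forall>k. True \<and> (e k < e (Suc k) \<and> (\<exists>F\<subseteq>{e k..<e (Suc k)}. large k F))"
  proof (rule dependent_nat_choice)
    fix x k :: nat
    obtain F where F: "F \<subseteq> {x..}" "large k F"
      using infinite_has_large_subset[OF infinite_Ici] by metis
    obtain m where m: "\<And>y. y \<in> F \<Longrightarrow> y < m"
      using large_imp_finite[OF F(2)] unfolding finite_nat_set_iff_bounded by metis
    have "F \<subseteq> {x..<max m (Suc x)}" using F(1) m by fastforce
    then show "\<exists>y. True \<and> (x < y \<and> (\<exists>F\<subseteq>{x..<y}. large k F))"
      using F(2) by (intro exI[of _ "max m (Suc x)"]) auto
  qed simp
  then obtain e where
    "\<forall>k. True \<and> (e k < e (Suc k) \<and> (\<exists>F\<subseteq>{e k..<e (Suc k)}. large k F))"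
    by (elim exE) (rule that)
  then have "block_large e"
    by unfold_locales (simp_all add: strict_mono_Suc_iff block_def)
  then show ?thesis by blast
qed

theorem theorem1p10:
  assumes CH: Continuum_Hypothesis
  shows
    "(\<exists>S :: nat filter set. |S| =o two_to_continuum \<and>
        (\<forall>U\<in>S. p_point U \<and> \<not> quasi_selective U) \<and>
        pairwise (\<lambda>U V. \<not> isomorphic_ultrafilters U V) S) \<and>
     (\<exists>S :: nat filter set. |S| =o two_to_continuum \<and>
        (\<forall>U\<in>S. quasi_selective U \<and> \<not> selective U) \<and>
        pairwise (\<lambda>U V. \<not> isomorphic_ultrafilters U V) S)"
proof
  show "\<exists>S :: nat filter set. |S| =o two_to_continuum \<and>
      (\<forall>U\<in>S. p_point U \<and> \<not> quasi_selective U) \<and>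
      pairwise (\<lambda>U V. \<not> isomorphic_ultrafilters U V) S"
    using CH by (rule many_p_points_not_quasi_selective)
  obtain e where "block_large e" using block_large_exists by blast
  then show "\<exists>S :: nat filter set. |S| =o two_to_continuum \<and>
      (\<forall>U\<in>S. quasi_selective U \<and> \<not> selective U) \<and>
      pairwise (\<lambda>U V. \<not> isomorphic_ultrafilters U V) S"
    using CH by (rule block_large.many_quasi_selective)
qed

end
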